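(* Let $(G,\omega)$, $G=(V,E)$, be a finite, connected, loop-free directed multigraph with positive integer arc weight $\omega:E\to\mathbb{N}^+$ such that every arc lies on a directed cycle. Then $$\Omega(G,\omega)\ \ge\ \max\{\mu(G,\omega),\upsilon(G,\omega)\}.$$ Moreover, there are infinitely many such weighted graphs $(G,\omega)$ with $\mu(G,\omega)=\Omega(G,\omega)$ or $\upsilon(G,\omega)=\Omega(G,\omega)$.
   Context: $\Omega(G,\omega)$ is the minimum of $\sum_{e\in\epsilon}\omega(e)$ over all $\epsilon\subseteq E$ with $G\setminus\epsilon$ acyclic (no directed cycle). $O_{el}(G)$ is the set of elementary cycles (directed cycles visiting no vertex twice). For $e\in E$: $\theta_G(e)$ is the number of elementary cycles containing $e$; $\varphi_G(e)$ is the number of arcs of the subgraph $G_{el}(e)$ induced by all elementary cycles containing $e$; $\xi_{G,\omega}(e)=\theta_G(e)/\omega(e)$ and $\eta_{G,\omega}(e)=\varphi_G(e)/\omega(e)$. Let $\xi_{\max}=\max_{e\in E}\xi_{G,\omega}(e)$, $\eta_{\max}=\max_{e\in E}\eta_{G,\omega}(e)$, $\mu(G,\omega)=\lceil |O_{el}(G)|/\xi_{\max}\rceil$ and $\upsilon(G,\omega)=\lceil |E|/\eta_{\max}\rceil$. *)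

theory Defs
  imports
    Complex_Main
    "Graph_Theory.Digraph"
    "Graph_Theory.Arc_Walk"
    "Graph_Theory.Digraph_Component"
    "Graph_Theory.Digraph_Isomorphism"
begin

text \<open>A directed cycle is a nonempty closed arc walk (\<open>closed_w\<close>), possibly repeating vertices;
  an elementary cycle is one that visits no vertex twice (\<open>cycle\<close>, cf. \<open>cycle_altdef\<close>). Parallel
  arcs are allowed, loops are not. \<open>connected\<close> is connectedness of the underlying
  undirected graph and includes nonemptiness of the vertex set.\<close>

locale weighted_cyclic_digraph = fin_digraph G + loopfree_digraph G
  for G :: "('a, 'b) pre_digraph" (structure) +
  fixes \<omega> :: "'b \<Rightarrow> nat"
  assumes connected: "connected G"
    and weight_pos: "e \<in> arcs G \<Longrightarrow> 0 < \<omega> e"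
    and arc_on_cycle: "e \<in> arcs G \<Longrightarrow> \<exists>p. closed_w p \<and> e \<in> set p"

definition del_arcs :: "('a, 'b) pre_digraph \<Rightarrow> 'b set \<Rightarrow> ('a, 'b) pre_digraph" where
  "del_arcs G \<epsilon> = G\<lparr>arcs := arcs G - \<epsilon>\<rparr>"

definition acyclic_digraph :: "('a, 'b) pre_digraph \<Rightarrow> bool" where
  "acyclic_digraph G \<longleftrightarrow> \<not> (\<exists>p. wf_digraph.closed_w G p)"

definition min_feedback :: "('a, 'b) pre_digraph \<Rightarrow> ('b \<Rightarrow> nat) \<Rightarrow> nat" where
  "min_feedback G \<omega> = Min {(\<Sum>e\<in>\<epsilon>. \<omega> e) | \<epsilon>. \<epsilon> \<subseteq> arcs G \<and> acyclic_digraph (del_arcs G \<epsilon>)}"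

text \<open>The predicate \<open>cycle\<close> holds of an arc list with a chosen starting point. Cycles are
  counted without one; since the arcs of an elementary cycle determine it up to rotation,
  we represent the cycle by its arc set.\<close>

definition elementary_cycles :: "('a, 'b) pre_digraph \<Rightarrow> 'b set set" where
  "elementary_cycles G = {set p | p. pre_digraph.cycle G p}"

definition elementary_cycles_through :: "('a, 'b) pre_digraph \<Rightarrow> 'b \<Rightarrow> 'b set set" where
  "elementary_cycles_through G e = {c \<in> elementary_cycles G. e \<in> c}"

text \<open>The subgraph induced by a set of cycles is their union, i.e. it is induced by arcs,
  not by vertices.\<close>

definition cycle_subgraph :: "('a, 'b) pre_digraph \<Rightarrow> 'b \<Rightarrow> ('a, 'b) pre_digraph" where
  "cycle_subgraph G e =
     (let A = \<Union> (elementary_cycles_through G e)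
      in G\<lparr>verts := tail G ` A \<union> head G ` A, arcs := A\<rparr>)"

definition \<theta> :: "('a, 'b) pre_digraph \<Rightarrow> 'b \<Rightarrow> nat" where
  "\<theta> G e = card (elementary_cycles_through G e)"

definition \<phi> :: "('a, 'b) pre_digraph \<Rightarrow> 'b \<Rightarrow> nat" where
  "\<phi> G e = card (arcs (cycle_subgraph G e))"

definition \<xi> :: "('a, 'b) pre_digraph \<Rightarrow> ('b \<Rightarrow> nat) \<Rightarrow> 'b \<Rightarrow> real" where
  "\<xi> G \<omega> e = real (\<theta> G e) / real (\<omega> e)"

definition \<eta> :: "('a, 'b) pre_digraph \<Rightarrow> ('b \<Rightarrow> nat) \<Rightarrow> 'b \<Rightarrow> real" where
  "\<eta> G \<omega> e = real (\<phi> G e) / real (\<omega> e)"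

definition \<xi>_max :: "('a, 'b) pre_digraph \<Rightarrow> ('b \<Rightarrow> nat) \<Rightarrow> real" where
  "\<xi>_max G \<omega> = (MAX e\<in>arcs G. \<xi> G \<omega> e)"

definition \<eta>_max :: "('a, 'b) pre_digraph \<Rightarrow> ('b \<Rightarrow> nat) \<Rightarrow> real" where
  "\<eta>_max G \<omega> = (MAX e\<in>arcs G. \<eta> G \<omega> e)"

text \<open>Without arcs the maxima above are unspecified, but both numerators below are then 0
  and hence so are both bounds.\<close>

definition \<mu> :: "('a, 'b) pre_digraph \<Rightarrow> ('b \<Rightarrow> nat) \<Rightarrow> int" where
  "\<mu> G \<omega> = \<lceil>real (card (elementary_cycles G)) / \<xi>_max G \<omega>\<rceil>"

definition \<upsilon> :: "('a, 'b) pre_digraph \<Rightarrow> ('b \<Rightarrow> nat) \<Rightarrow> int" where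
  "\<upsilon> G \<omega> = \<lceil>real (card (arcs G)) / \<eta>_max G \<omega>\<rceil>"

text \<open>Isomorphisms in the sense of \<open>digraph_iso\<close> that also preserve the weights.\<close>

definition weighted_iso ::
  "('a, 'b) pre_digraph \<times> ('b \<Rightarrow> nat) \<Rightarrow> ('c, 'd) pre_digraph \<times> ('d \<Rightarrow> nat) \<Rightarrow> bool" where
  "weighted_iso = (\<lambda>(G, \<omega>) (H, \<omega>').
     \<exists>hom. pre_digraph.digraph_isomorphism G hom \<and> H = app_iso hom G \<and>
       (\<forall>e\<in>arcs G. \<omega>' (iso_arcs hom e) = \<omega> e))"

end

theory Submission
  imports Defs
begin

text \<open>A feedback arc set \<open>F\<close> meets every elementary cycle, and every arc shares an elementary cycle
  with some arc of \<open>F\<close>. Hence the number of elementary cycles is at most the sum of \<open>\<theta>\<close> over \<open>F\<close>,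
  and the number of arcs is at most the sum of \<open>\<phi>\<close> over \<open>F\<close>; bounding \<open>\<theta>\<close> and \<open>\<phi>\<close> by \<open>\<xi>_max\<close> and
  \<open>\<eta>_max\<close> times the weight gives both inequalities. Sharpness of the bound \<open>\<upsilon>\<close> is attained by the
  directed 2-cycles whose two arcs have equal weight; different weights give non-isomorphic
  examples.\<close>

lemma del_arcs_simps [simp]:
  "verts (del_arcs G \<epsilon>) = verts G" "arcs (del_arcs G \<epsilon>) = arcs G - \<epsilon>"
  "tail (del_arcs G \<epsilon>) = tail G" "head (del_arcs G \<epsilon>) = head G"
  by (simp_all add: del_arcs_def)

text \<open>\<open>cas\<close> consults only \<open>tail\<close> and \<open>head\<close>, never the
  arc set. So deleting arcs can affect a walk only through membership of its arcs.\<close>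

lemma cas_cong:
  assumes "tail G = tail H" "head G = head H"
  shows "pre_digraph.cas G u p v \<longleftrightarrow> pre_digraph.cas H u p v"
  using assms by (induction p arbitrary: u) (auto simp: pre_digraph.cas.simps)

context wf_digraph
begin

lemma wf_digraph_del_arcs: "wf_digraph (del_arcs G \<epsilon>)"
  by unfold_locales auto

lemma closed_w_del_arcs_iff:
  "wf_digraph.closed_w (del_arcs G \<epsilon>) p \<longleftrightarrow> closed_w p \<and> set p \<inter> \<epsilon> = {}"
  unfolding wf_digraph.closed_w_def[OF wf_digraph_del_arcs] closed_w_def pre_digraph.awalk_def
  using cas_cong[of "del_arcs G \<epsilon>" G] by auto

text \<open>Turns acyclicity after deletion into a hitting condition on the closed walks of
  \<open>G\<close> itself, so that later proofs need not work inside the smaller digraph.\<close>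

lemma acyclic_del_arcs_iff:
  "acyclic_digraph (del_arcs G \<epsilon>) \<longleftrightarrow> (\<forall>p. closed_w p \<longrightarrow> set p \<inter> \<epsilon> \<noteq> {})"
  unfolding acyclic_digraph_def by (auto simp: closed_w_del_arcs_iff)

lemma closed_w_subset_arcs: "closed_w p \<Longrightarrow> set p \<subseteq> arcs G"
  by (auto simp: closed_w_def)

lemma elementary_cycle_subset_arcs: "c \<in> elementary_cycles G \<Longrightarrow> c \<subseteq> arcs G"
  by (auto simp: elementary_cycles_def cycle_altdef dest: closed_w_subset_arcs)

lemma elementary_cycle_meets_feedback:
  assumes "c \<in> elementary_cycles G" "acyclic_digraph (del_arcs G \<epsilon>)"
  shows "\<exists>e\<in>\<epsilon>. e \<in> c"
  using assms by (auto simp: elementary_cycles_def acyclic_del_arcs_iff cycle_altdef)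

text \<open>Rotate the closed walk so that it starts with \<open>e\<close>. The rest leads from the
  head of \<open>e\<close> back to its tail; shorten it to a path and put \<open>e\<close> in front
  again.\<close>

lemma closed_w_imp_elementary_cycle:
  assumes "closed_w p" "e \<in> set p"
  shows "\<exists>c\<in>elementary_cycles G. e \<in> c"
proof -
  obtain u where u: "awalk u p u"
    using assms by (auto simp: closed_w_def)
  obtain q r where p: "p = q @ e # r"
    using \<open>e \<in> set p\<close> by (auto simp: in_set_conv_decomp)
  have e: "e \<in> arcs G" and "awalk (head G e) r u" "awalk u q (tail G e)"
    using u by (auto simp: p awalk_append_iff awalk_Cons_iff)
  then have "awalk (head G e) (r @ q) (tail G e)"
    by (auto simp: awalk_append_iff)
  then obtain s where s: "apath (head G e) s (tail G e)"
    using apath_awalk_to_apath by blast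
  then have "awalk (tail G e) (e # s) (tail G e)"
    using e by (auto simp: apath_def awalk_Cons_iff)
  \<comment> \<open>Dropping the first vertex of \<open>e # s\<close> leaves exactly the vertices of
    the path \<open>s\<close>.\<close>
  moreover have "distinct (tl (awalk_verts (tail G e) (e # s)))"
    using s by (auto simp: apath_def)
  ultimately have "cycle (e # s)"
    unfolding cycle_def by blast
  then show ?thesis
    unfolding elementary_cycles_def by (intro bexI[of _ "set (e # s)"] CollectI exI[of _ "e # s"]) auto
qed

end

context fin_digraph
begin

lemma finite_elementary_cycles: "finite (elementary_cycles G)"
  by (rule finite_subset[of _ "Pow (arcs G)"]) (auto dest: elementary_cycle_subset_arcs)

lemma finite_feedback_weights:
  "finite {(\<Sum>e\<in>\<epsilon>. \<omega> e) | \<epsilon>. \<epsilon> \<subseteq> arcs G \<and> acyclic_digraph (del_arcs G \<epsilon>)}"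
  by (rule finite_subset[of _ "sum \<omega> ` Pow (arcs G)"]) auto

lemma min_feedback_le:
  assumes "\<epsilon> \<subseteq> arcs G" "acyclic_digraph (del_arcs G \<epsilon>)"
  shows "min_feedback G \<omega> \<le> (\<Sum>e\<in>\<epsilon>. \<omega> e)"
  unfolding min_feedback_def using assms by (intro Min_le finite_feedback_weights) blast

lemma min_feedback_attained:
  obtains \<epsilon> where "\<epsilon> \<subseteq> arcs G" "acyclic_digraph (del_arcs G \<epsilon>)"
    "min_feedback G \<omega> = (\<Sum>e\<in>\<epsilon>. \<omega> e)"
proof -
  \<comment> \<open>Closed walks are nonempty, so removing all arcs destroys every one of them. This
    keeps \<open>Min\<close> from being applied to an empty set.\<close>
  have "acyclic_digraph (del_arcs G (arcs G))"
    unfolding acyclic_del_arcs_iff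
    by (metis closed_w_def closed_w_subset_arcs inf.absorb1 length_greater_0_conv set_empty)
  then have "{(\<Sum>e\<in>\<epsilon>. \<omega> e) | \<epsilon>. \<epsilon> \<subseteq> arcs G \<and> acyclic_digraph (del_arcs G \<epsilon>)} \<noteq> {}"
    by blast
  from Min_in[OF finite_feedback_weights this] show ?thesis
    using that unfolding min_feedback_def by blast
qed

end

text \<open>The arithmetic common to both bounds, with \<open>f\<close> standing for \<theta> or
  \<phi>. The weight sum is an integer, so an upper bound on the quotient survives rounding
  up.\<close>

lemma ceiling_card_div_le_sum:
  fixes f w :: "'b \<Rightarrow> nat" and g :: "'b \<Rightarrow> real" and m :: real
  assumes "finite E" "\<epsilon> \<subseteq> E" "\<And>e. e \<in> E \<Longrightarrow> 0 < w e"
    and "\<And>e. g e = real (f e) / real (w e)" "m = (MAX e\<in>E. g e)"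
    and N: "N \<le> (\<Sum>e\<in>\<epsilon>. f e)"
  shows "\<lceil>real N / m\<rceil> \<le> int (\<Sum>e\<in>\<epsilon>. w e)"
\<comment> \<open>If \<open>E\<close> is empty, \<open>m\<close> is unspecified; but then
  \<open>N\<close> is 0 and the quotient is 0 for any \<open>m\<close>.\<close>
proof (cases "N = 0")
  case False
  have f_le: "real (f e) \<le> m * real (w e)" if "e \<in> \<epsilon>" for e
  proof -
    have "real (f e) / real (w e) \<le> m"
      using assms that by (auto intro!: Max_ge)
    moreover have "0 < w e"
      using assms that by auto
    ultimately show ?thesis
      by (simp add: field_simps)
  qed
  have "real N \<le> (\<Sum>e\<in>\<epsilon>. real (f e))"
    using N by (metis of_nat_le_iff of_nat_sum)
  also have "\<dots> \<le> m * real (\<Sum>e\<in>\<epsilon>. w e)"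
    using f_le by (auto simp: sum_distrib_left intro: sum_mono)
  finally have le: "real N \<le> m * real (\<Sum>e\<in>\<epsilon>. w e)" .
  \<comment> \<open>The estimate itself forces this: a nonpositive \<open>m\<close> would make its
    right side nonpositive, while \<open>N\<close> is positive.\<close>
  then have "0 < m"
    using False by (smt (verit) mult_nonpos_nonneg of_nat_0_le_iff of_nat_0_less_iff neq0_conv)
  then have "real N / m \<le> real (\<Sum>e\<in>\<epsilon>. w e)"
    using le by (simp add: field_simps)
  then show ?thesis
    by (simp add: ceiling_le_iff)
qed (simp add: sum_nonneg)

context weighted_cyclic_digraph
begin

lemma arc_on_elementary_cycle: "e \<in> arcs G \<Longrightarrow> \<exists>c\<in>elementary_cycles G. e \<in> c"
  using arc_on_cycle closed_w_imp_elementary_cycle by blast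

lemma arcs_cycle_subgraph_subset: "arcs (cycle_subgraph G e) \<subseteq> arcs G"
  using elementary_cycle_subset_arcs
  by (auto simp: cycle_subgraph_def elementary_cycles_through_def Let_def)

lemma \<mu>_le_min_feedback: "\<mu> G \<omega> \<le> int (min_feedback G \<omega>)"
proof -
  obtain \<epsilon> where \<epsilon>: "\<epsilon> \<subseteq> arcs G" "acyclic_digraph (del_arcs G \<epsilon>)"
    and min: "min_feedback G \<omega> = (\<Sum>e\<in>\<epsilon>. \<omega> e)"
    by (rule min_feedback_attained)
  have fin: "finite \<epsilon>"
    using \<epsilon>(1) finite_arcs by (rule finite_subset)
  have "elementary_cycles G \<subseteq> (\<Union>e\<in>\<epsilon>. elementary_cycles_through G e)"
    using elementary_cycle_meets_feedback[OF _ \<epsilon>(2)]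
    by (auto simp: elementary_cycles_through_def)
  then have "card (elementary_cycles G) \<le> card (\<Union>e\<in>\<epsilon>. elementary_cycles_through G e)"
    using fin finite_elementary_cycles
    by (intro card_mono) (auto simp: elementary_cycles_through_def)
  \<comment> \<open>A cycle containing several arcs of \<epsilon> is counted once for each of
    them.\<close>
  also have "\<dots> \<le> (\<Sum>e\<in>\<epsilon>. \<theta> G e)"
    unfolding \<theta>_def by (rule card_UN_le[OF fin])
  finally show ?thesis
    unfolding \<mu>_def min using \<epsilon>
    by (intro ceiling_card_div_le_sum[where f = "\<theta> G" and g = "\<xi> G \<omega>" and E = "arcs G"])
      (auto simp: \<xi>_def \<xi>_max_def weight_pos)
qed

lemma \<upsilon>_le_min_feedback: "\<upsilon> G \<omega> \<le> int (min_feedback G \<omega>)"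
proof -
  obtain \<epsilon> where \<epsilon>: "\<epsilon> \<subseteq> arcs G" "acyclic_digraph (del_arcs G \<epsilon>)"
    and min: "min_feedback G \<omega> = (\<Sum>e\<in>\<epsilon>. \<omega> e)"
    by (rule min_feedback_attained)
  have fin: "finite \<epsilon>"
    using \<epsilon>(1) finite_arcs by (rule finite_subset)
  have "arcs G \<subseteq> (\<Union>e\<in>\<epsilon>. arcs (cycle_subgraph G e))"
    using elementary_cycle_meets_feedback[OF _ \<epsilon>(2)] arc_on_elementary_cycle
    by (fastforce simp: cycle_subgraph_def elementary_cycles_through_def Let_def)
  then have "card (arcs G) \<le> card (\<Union>e\<in>\<epsilon>. arcs (cycle_subgraph G e))"
    using fin arcs_cycle_subgraph_subset
    by (intro card_mono) (auto intro: finite_subset[OF _ finite_arcs])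
  also have "\<dots> \<le> (\<Sum>e\<in>\<epsilon>. \<phi> G e)"
    unfolding \<phi>_def by (rule card_UN_le[OF fin])
  finally show ?thesis
    unfolding \<upsilon>_def min using \<epsilon>
    by (intro ceiling_card_div_le_sum[where f = "\<phi> G" and g = "\<eta> G \<omega>" and E = "arcs G"])
      (auto simp: \<eta>_def \<eta>_max_def weight_pos)
qed

text \<open>Since \<phi> never exceeds the number of arcs, the maximal \<eta> is at most that number
  divided by \<open>k\<close>. The quotient is thus at least \<open>k\<close> even before
  rounding.\<close>

lemma constant_weight_le_\<upsilon>:
  assumes "arcs G \<noteq> {}" "\<And>e. e \<in> arcs G \<Longrightarrow> \<omega> e = k"
  shows "int k \<le> \<upsilon> G \<omega>"
proof -
  have k: "0 < k"
    using assms weight_pos by force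
  obtain e where e: "e \<in> arcs G" "\<eta>_max G \<omega> = \<eta> G \<omega> e"
    using Max_in[of "\<eta> G \<omega> ` arcs G"] assms(1) unfolding \<eta>_max_def by fastforce
  have "e \<in> arcs (cycle_subgraph G e)"
    using arc_on_elementary_cycle[OF e(1)]
    by (auto simp: cycle_subgraph_def elementary_cycles_through_def Let_def)
  \<comment> \<open>Otherwise the quotient would be a division by zero, with value 0.\<close>
  then have pos: "0 < \<phi> G e"
    unfolding \<phi>_def card_gt_0_iff
    using arcs_cycle_subgraph_subset[of e] finite_subset[OF _ finite_arcs] by blast
  have "\<phi> G e \<le> card (arcs G)"
    unfolding \<phi>_def by (intro card_mono finite_arcs arcs_cycle_subgraph_subset)
  then have "real k \<le> real (card (arcs G)) / \<eta>_max G \<omega>"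
    using pos k assms(2)[OF e(1)] by (simp add: e(2) \<eta>_def field_simps)
  then show ?thesis
    unfolding \<upsilon>_def by linarith
qed

end

definition two_cycle :: "(nat, nat) pre_digraph" where
  "two_cycle = \<lparr>verts = {0, 1}, arcs = {0, 1}, tail = id, head = \<lambda>e. 1 - e\<rparr>"

lemma two_cycle_simps [simp]:
  "verts two_cycle = {0, 1}" "arcs two_cycle = {0, 1}"
  "tail two_cycle = id" "head two_cycle = (\<lambda>e. 1 - e)"
  by (simp_all add: two_cycle_def)

interpretation two_cycle: fin_digraph two_cycle
  by unfold_locales auto

lemma weighted_cyclic_digraph_two_cycle:
  assumes "0 < k"
  shows "weighted_cyclic_digraph two_cycle (\<lambda>_. k)"
proof unfold_locales
  \<comment> \<open>Undirected connectedness is obtained from directed reachability between any two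
    vertices.\<close>
  have "u \<rightarrow>\<^sup>*\<^bsub>two_cycle\<^esub> v" if "u \<in> {0, 1}" "v \<in> {0, 1}" for u v
    using that two_cycle.in_arcs_imp_in_arcs_ends[of 0] two_cycle.in_arcs_imp_in_arcs_ends[of 1]
    by (auto intro: two_cycle.reachable_adjI)
  then show "connected two_cycle"
    by (intro two_cycle.connectedI two_cycle.reachable_mk_symmetricI) auto
next
  fix e assume "e \<in> arcs two_cycle"
  moreover have "two_cycle.closed_w [0, 1]"
    by (auto simp: two_cycle.closed_w_def two_cycle.awalk_simps)
  ultimately show "\<exists>p. two_cycle.closed_w p \<and> e \<in> set p"
    by (intro exI[of _ "[0, 1]"]) auto
qed (use assms in auto)

lemma min_feedback_two_cycle_le: "min_feedback two_cycle (\<lambda>_. k) \<le> k"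
proof -
  have "set p \<inter> {0} \<noteq> {}" if p: "two_cycle.closed_w p" for p
  proof (rule ccontr)
    assume "\<not> set p \<inter> {0} \<noteq> {}"
    then have "set p \<subseteq> {1}"
      using two_cycle.closed_w_subset_arcs[OF p] by auto
    moreover obtain u where "two_cycle.awalk u p u" "p \<noteq> []"
      using p unfolding two_cycle.closed_w_def length_greater_0_conv by blast
    ultimately show False
      by (cases p; cases "tl p") (auto simp: two_cycle.awalk_simps)
  qed
  then have "acyclic_digraph (del_arcs two_cycle {0})"
    by (simp add: two_cycle.acyclic_del_arcs_iff)
  from two_cycle.min_feedback_le[OF _ this, of "\<lambda>_. k"] show ?thesis
    by simp
qed

text \<open>The chain \<open>k\<close> \<le> \<upsilon> \<le> \<open>min_feedback\<close> \<le>
  \<open>k\<close> collapses to equalities.\<close>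

lemma \<upsilon>_two_cycle:
  assumes "0 < k"
  shows "\<upsilon> two_cycle (\<lambda>_. k) = int (min_feedback two_cycle (\<lambda>_. k))"
proof -
  interpret weighted_cyclic_digraph two_cycle "\<lambda>_. k"
    by (rule weighted_cyclic_digraph_two_cycle[OF assms])
  show ?thesis
    using \<upsilon>_le_min_feedback constant_weight_le_\<upsilon>[of k] min_feedback_two_cycle_le[of k] by simp
qed

text \<open>Both weights are constant, so comparing them at a single arc suffices, wherever the
  isomorphism sends it.\<close>

lemma weighted_iso_two_cycle:
  assumes "weighted_iso (two_cycle, \<lambda>_. k) (two_cycle, \<lambda>_. l)"
  shows "k = l"
  using assms by (auto simp: weighted_iso_def)

theorem theorem10:
  shows "(\<forall>(G :: ('a, 'b) pre_digraph) \<omega>. weighted_cyclic_digraph G \<omega> \<longrightarrow>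
            int (min_feedback G \<omega>) \<ge> max (\<mu> G \<omega>) (\<upsilon> G \<omega>)) \<and>
         (\<exists>S :: ((nat, nat) pre_digraph \<times> (nat \<Rightarrow> nat)) set.
            infinite S \<and>
            pairwise (\<lambda>X Y. \<not> weighted_iso X Y) S \<and>
            (\<forall>(G, \<omega>)\<in>S. weighted_cyclic_digraph G \<omega> \<and>
               (\<mu> G \<omega> = int (min_feedback G \<omega>) \<or> \<upsilon> G \<omega> = int (min_feedback G \<omega>))))"
proof (intro conjI allI impI exI)
  fix G :: "('a, 'b) pre_digraph" and \<omega>
  assume "weighted_cyclic_digraph G \<omega>"
  then interpret weighted_cyclic_digraph G \<omega> .
  show "int (min_feedback G \<omega>) \<ge> max (\<mu> G \<omega>) (\<upsilon> G \<omega>)"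
    using \<mu>_le_min_feedback \<upsilon>_le_min_feedback by simp
next
  \<comment> \<open>One fixed digraph, with only the weight varying; \<open>Suc\<close> keeps it
    positive.\<close>
  let ?X = "\<lambda>k. (two_cycle, \<lambda>_::nat. Suc k)"
  have "inj ?X"
    by (auto intro!: injI dest: fun_cong)
  then show "infinite (range ?X)"
    by (rule range_inj_infinite)
  show "pairwise (\<lambda>X Y. \<not> weighted_iso X Y) (range ?X)"
    by (auto simp: pairwise_def dest: weighted_iso_two_cycle)
  show "\<forall>(G, \<omega>)\<in>range ?X. weighted_cyclic_digraph G \<omega> \<and>
      (\<mu> G \<omega> = int (min_feedback G \<omega>) \<or> \<upsilon> G \<omega> = int (min_feedback G \<omega>))"
    using weighted_cyclic_digraph_two_cycle \<upsilon>_two_cycle by auto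
qed

end
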